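(* Let $\mathcal{H}$ be a separable complex Hilbert space and let $A$ be a nonzero compact antilinear operator on $\mathcal{H}$. Then there exists a nontrivial closed complex linear subspace $\mathcal{M}$ of $\mathcal{H}$ (that is, $\{0\}\neq\mathcal{M}\neq\mathcal{H}$) that is invariant under every operator $T\in\langle A\rangle$, i.e. $T\mathcal{M}\subset\mathcal{M}$ for every $T\in\langle A\rangle$.
   Context: An operator $R:\mathcal{H}\to\mathcal{H}$ is real linear if $R(x+y)=Rx+Ry$ and $R(rx)=rRx$ for all $x,y\in\mathcal{H}$, $r\in\mathbb{R}$. It is antilinear if moreover $R(ix)=-iRx$ for all $x$. An antilinear operator is compact if it maps bounded sets to sets with compact closure. The operator norm is $\|R\|=\sup\{\|Rx\| : \|x\|=1\}$. For a complex polynomial $p(z)=\sum_{j=0}^N a_jz^j$, $a_j\in\mathbb{C}$, the operator $p(A)$ is the real linear operator $\sum_{j=0}^N a_jA^j$ (with $A^0=I$), i.e. $p(A)x=\sum_{j=0}^N a_j (A^jx)$. The set $\langle A\rangle$ is the closure, in the operator norm (within the bounded real linear operators on $\mathcal{H}$), of the set of all polynomials $p(A)$ in $A$ with complex coefficients.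
   Formalization: The Hilbert space is additionally assumed to have complex dimension at least 3 (possibly infinite); the claim fails in dimension 1 (A = complex conjugation on C) and in dimension 2 (A(z,w) = (-conj w, conj z), where A^2 = -I rules out an invariant line). *)

theory Defs
  imports "HOL-Analysis.Analysis" "HOL-Computational_Algebra.Polynomial"
begin

(* Complex Hilbert spaces. The parent class banach supplies the real scalar multiplication, the
   norm, its topology and completeness; the axioms below say that the real structure is the
   restriction of a complex one and that the norm is induced by a complex inner product. The inner
   product is linear in its first argument. Positive definiteness follows from cinner_self. *)
class complex_hilbert = banach +
  fixes scaleC :: "complex \<Rightarrow> 'a \<Rightarrow> 'a"  (infixr \<open>*\<^sub>C\<close> 75)
    and cinner :: "'a \<Rightarrow> 'a \<Rightarrow> complex"
  assumes scaleC_add_right: "c *\<^sub>C (x + y) = c *\<^sub>C x + c *\<^sub>C y"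
    and scaleC_add_left: "(c + d) *\<^sub>C x = c *\<^sub>C x + d *\<^sub>C x"
    and scaleC_scaleC: "c *\<^sub>C d *\<^sub>C x = (c * d) *\<^sub>C x"
    and scaleC_one: "1 *\<^sub>C x = x"
    and scaleR_scaleC: "r *\<^sub>R x = complex_of_real r *\<^sub>C x"
    and cinner_add_left: "cinner (x + y) z = cinner x z + cinner y z"
    and cinner_scaleC_left: "cinner (c *\<^sub>C x) y = c * cinner x y"
    and cinner_commute: "cinner y x = cnj (cinner x y)"
    and cinner_self: "cinner x x = complex_of_real ((norm x)\<^sup>2)"

global_interpretation complex_vector:
  vector_space "scaleC :: complex \<Rightarrow> 'a \<Rightarrow> 'a :: complex_hilbert"
  defines csubspace_raw_def: csubspace = complex_vector.subspace
    and cdependent_raw_def: cdependent = complex_vector.dependent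
  by unfold_locales (rule scaleC_add_right scaleC_add_left scaleC_scaleC scaleC_one)+

abbreviation cindependent :: "'a :: complex_hilbert set \<Rightarrow> bool" where
  "cindependent S \<equiv> \<not> cdependent S"

definition separable :: "'a :: topological_space itself \<Rightarrow> bool" where
  "separable _ \<longleftrightarrow> (\<exists>D :: 'a set. countable D \<and> closure D = UNIV)"

(* linear is linearity over the reals. *)
definition antilinear :: "('a :: complex_hilbert \<Rightarrow> 'a) \<Rightarrow> bool" where
  "antilinear R \<longleftrightarrow> linear R \<and> (\<forall>x. R (\<i> *\<^sub>C x) = - (\<i> *\<^sub>C R x))"

definition compact_operator :: "('a :: real_normed_vector \<Rightarrow> 'b :: real_normed_vector) \<Rightarrow> bool" where
  "compact_operator R \<longleftrightarrow> (\<forall>S. bounded S \<longrightarrow> compact (closure (R ` S)))"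

definition poly_op :: "complex poly \<Rightarrow> ('a :: complex_hilbert \<Rightarrow> 'a) \<Rightarrow> 'a \<Rightarrow> 'a" where
  "poly_op p A = (\<lambda>x. \<Sum>j\<le>degree p. coeff p j *\<^sub>C (A ^^ j) x)"

(* The type of bounded real linear operators carries the operator norm onorm, so closure is the
   operator norm closure. For bounded real linear A, every poly_op p A is a bounded real linear
   operator. *)
definition generated :: "('a :: complex_hilbert \<Rightarrow> 'a) \<Rightarrow> ('a \<Rightarrow>\<^sub>L 'a) set" where
  "generated A = closure {P. \<exists>p. blinfun_apply P = poly_op p A}"

end

theory Submission
  imports Defs "HOL-Complex_Analysis.Cauchy_Integral_Formula"
begin

text \<open>
  A closed complex subspace that \<open>A\<close> maps into itself is invariant under every polynomial in \<open>A\<close>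
  and, being closed, under every norm limit of such polynomials (\<open>generated_invariant\<close>). So it is
  enough to find a nontrivial closed complex subspace invariant under \<open>A\<close>. Suppose there is none;
  the locale \<open>transitive_compact_antilinear\<close> collects this hypothesis and derives a contradiction.
  The argument is Hilden's proof of Lomonosov's theorem, adapted to the fact that \<open>A\<close> does not
  commute with nonreal scalars.

  The square \<open>K = A\<^sup>2\<close> is complex linear and compact. An eigenvector \<open>x\<close> of \<open>K\<close> would make the
  span of \<open>x\<close> and \<open>A x\<close> invariant, and its closure is a proper subspace in dimension at least three
  (\<open>no_eigenvector_K\<close>). In dimension two the map \<open>(a, b) \<mapsto> (- cnj b, cnj a)\<close> shows that this is where
  the dimension matters. Hence every \<open>I - s K\<close> is injective and, by compactness, bounded below. The
  operator \<open>(I - s K) (I - cnj s K)\<close> has real coefficients as a polynomial in \<open>K\<close>, so it commutes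
  with \<open>A\<close>; its range is therefore a nonzero closed invariant subspace, that is, everything. This
  makes \<open>I - s K\<close> invertible (\<open>surj_W\<close>). The
  resolvent is then entire, and Cauchy's inequality shows that \<open>K\<^sup>n x\<close> decays faster than every
  geometric sequence (\<open>K_power_decay\<close>).

  Call a real linear operator \<open>P\<close> tempered if \<open>\<parallel>A\<^sup>k P x\<parallel> \<le> c \<parallel>A\<^sup>k x\<parallel>\<close> with one constant for all \<open>k\<close> and
  \<open>x\<close>. The values at \<open>y \<noteq> 0\<close> of the tempered operators form an invariant subspace, hence a
  dense one (\<open>orbit_dense\<close>). Take a ball \<open>B\<close> such that the compact set \<open>closure (A ` B)\<close> does not
  contain \<open>0\<close>. By compactness finitely many tempered operators suffice to throw every point of
  \<open>closure (A ` B)\<close> into \<open>B\<close>. Alternating between \<open>A\<close> and these operators yields points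
  \<open>x\<^sub>m\<close> of \<open>B\<close> with \<open>\<parallel>x\<^sub>m\<parallel> \<le> c\<^sup>m \<parallel>A\<^sup>m x\<^sub>0\<parallel>\<close>. The right-hand side tends to \<open>0\<close> along even \<open>m\<close>, whereas
  \<open>B\<close> stays away from \<open>0\<close>.
\<close>

section \<open>Complex Hilbert spaces\<close>

lemma cinner_add_right: "cinner x (y + z) = cinner x y + cinner x z"
  for x y z :: "'a :: complex_hilbert"
  by (metis cinner_add_left cinner_commute complex_cnj_add)

lemma cinner_scaleC_right: "cinner x (c *\<^sub>C y) = cnj c * cinner x y"
  for x y :: "'a :: complex_hilbert"
  by (metis cinner_commute cinner_scaleC_left complex_cnj_mult)

lemma cinner_diff_left: "cinner (x - y) z = cinner x z - cinner y z"
  for x y z :: "'a :: complex_hilbert"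
  by (metis add_diff_cancel_right' cinner_add_left diff_add_cancel)

lemma cinner_eq_zero_iff: "cinner x x = 0 \<longleftrightarrow> x = 0" for x :: "'a :: complex_hilbert"
  by (simp add: cinner_self)

lemma norm_scaleC: "norm (c *\<^sub>C x) = cmod c * norm x" for x :: "'a :: complex_hilbert"
proof -
  have "complex_of_real ((norm (c *\<^sub>C x))\<^sup>2) = c * cnj c * complex_of_real ((norm x)\<^sup>2)"
    by (simp only: cinner_self[symmetric] cinner_scaleC_left cinner_scaleC_right
        mult.assoc mult.left_commute)
  also have "\<dots> = complex_of_real ((cmod c * norm x)\<^sup>2)"
    by (simp add: complex_norm_square[symmetric] power_mult_distrib)
  finally have "(norm (c *\<^sub>C x))\<^sup>2 = (cmod c * norm x)\<^sup>2"
    using of_real_eq_iff by blast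
  then show ?thesis
    by (simp add: power2_eq_iff_nonneg)
qed

text \<open>
  The triangle inequality for \<open>norm (u + y)\<close> bounds the real part of the inner product; multiplying
  \<open>x\<close> by a suitable unimodular scalar turns the modulus into a real part.
\<close>

lemma norm_cinner_le: "cmod (cinner x y) \<le> norm x * norm y"
  for x y :: "'a :: complex_hilbert"
proof -
  have Re_le: "Re (cinner u y) \<le> norm u * norm y" for u
  proof -
    have "cinner (u + y) (u + y) = cinner u u + (cinner u y + cnj (cinner u y)) + cinner y y"
      by (simp add: cinner_add_left cinner_add_right cinner_commute[of y u])
    then have "(norm (u + y))\<^sup>2 = (norm u)\<^sup>2 + 2 * Re (cinner u y) + (norm y)\<^sup>2"
      by (simp add: complex_eq_iff cinner_self)
    moreover have "(norm (u + y))\<^sup>2 \<le> (norm u + norm y)\<^sup>2"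
      by (simp add: norm_triangle_ineq power_mono)
    ultimately show ?thesis
      by (simp add: power2_sum)
  qed
  define z where "z = cinner x y"
  define w where "w = cnj (sgn z)"
  have "w * z = cnj z * z / complex_of_real (cmod z)"
    by (simp add: w_def sgn_eq)
  also have "cnj z * z = complex_of_real ((cmod z)\<^sup>2)"
    by (metis complex_norm_square mult.commute)
  also have "\<dots> / complex_of_real (cmod z) = complex_of_real (cmod z)"
    by (simp add: power2_eq_square)
  finally have "cmod z = Re (cinner (w *\<^sub>C x) y)"
    by (simp add: cinner_scaleC_left z_def)
  also have "\<dots> \<le> norm (w *\<^sub>C x) * norm y"
    by (rule Re_le)
  also have "\<dots> \<le> norm x * norm y"
    by (auto simp: norm_scaleC w_def norm_sgn intro!: mult_right_mono)
  finally show ?thesis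
    by (simp add: z_def)
qed

lemma bounded_bilinear_scaleC:
  "bounded_bilinear (scaleC :: complex \<Rightarrow> 'a \<Rightarrow> 'a :: complex_hilbert)"
  by standard (auto simp: scaleC_add_left scaleC_add_right scaleR_scaleC scaleC_scaleC norm_scaleC
      scaleR_conv_of_real mult.commute intro!: exI[of _ 1])

lemma bounded_linear_cinner_left: "bounded_linear (\<lambda>x. cinner x y)"
  for y :: "'a :: complex_hilbert"
  by standard (auto simp: cinner_add_left scaleR_scaleC cinner_scaleC_left scaleR_conv_of_real
      intro!: exI[of _ "norm y"] norm_cinner_le)

lemma closure_csubspace:
  fixes S :: "'a :: complex_hilbert set"
  assumes S: "csubspace S"
  shows "csubspace (closure S)"
proof (rule complex_vector.subspaceI)
  show "0 \<in> closure S"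
    using complex_vector.subspace_0[OF S] closure_subset by blast
  show "x + y \<in> closure S" if xy: "x \<in> closure S" "y \<in> closure S" for x y
  proof -
    obtain f g where fg: "\<forall>n. f n \<in> S" "f \<longlonglongrightarrow> x" "\<forall>n. g n \<in> S" "g \<longlonglongrightarrow> y"
      using xy by (auto simp: closure_sequential)
    then have "\<forall>n. f n + g n \<in> S" "(\<lambda>n. f n + g n) \<longlonglongrightarrow> x + y"
      by (auto intro: complex_vector.subspace_add[OF S] tendsto_add)
    then show ?thesis
      unfolding closure_sequential by (intro exI[of _ "\<lambda>n. f n + g n"]) auto
  qed
  show "c *\<^sub>C x \<in> closure S" if x: "x \<in> closure S" for c x
  proof -
    obtain f where f: "\<forall>n. f n \<in> S" "f \<longlonglongrightarrow> x"
      using x by (auto simp: closure_sequential)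
    then have "\<forall>n. c *\<^sub>C f n \<in> S" "(\<lambda>n. c *\<^sub>C f n) \<longlonglongrightarrow> c *\<^sub>C x"
      by (auto intro: complex_vector.subspace_scale[OF S]
          bounded_bilinear.tendsto[OF bounded_bilinear_scaleC tendsto_const])
    then show ?thesis
      unfolding closure_sequential by (intro exI[of _ "\<lambda>n. c *\<^sub>C f n"]) auto
  qed
qed

text \<open>
  Gram--Schmidt. The quotients are harmless when \<open>x\<close> or \<open>w\<close> vanishes, because division by zero
  gives zero and the corresponding projection drops out.
\<close>

lemma exists_orthogonal_to_pair:
  fixes x y b :: "'a :: complex_hilbert"
  assumes b: "b \<notin> complex_vector.span {x, y}"
  obtains e where "e \<noteq> 0" "cinner x e = 0" "cinner y e = 0"
proof -
  define w where "w = y - (cinner y x / cinner x x) *\<^sub>C x"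
  define e where "e = b - (cinner b x / cinner x x) *\<^sub>C x - (cinner b w / cinner w w) *\<^sub>C w"
  have wx: "cinner w x = 0"
    by (cases "x = 0") (auto simp: w_def cinner_diff_left cinner_scaleC_left cinner_eq_zero_iff
        cinner_scaleC_right[of _ 0 x, simplified])
  then have xw: "cinner x w = 0"
    by (metis cinner_commute complex_cnj_zero)
  have "cinner e x = 0"
    using wx by (cases "x = 0") (auto simp: e_def cinner_diff_left cinner_scaleC_left
        cinner_eq_zero_iff cinner_scaleC_right[of _ 0 x, simplified])
  then have xe: "cinner x e = 0"
    by (metis cinner_commute complex_cnj_zero)
  have "cinner e w = 0"
    using xw by (cases "w = 0") (auto simp: e_def cinner_diff_left cinner_scaleC_left
        cinner_eq_zero_iff cinner_scaleC_right[of _ 0 x, simplified])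
  then have we: "cinner w e = 0"
    by (metis cinner_commute complex_cnj_zero)
  have "cinner y e = cinner w e + (cinner y x / cinner x x) * cinner x e"
    by (simp add: w_def cinner_diff_left cinner_scaleC_left)
  then have ye: "cinner y e = 0"
    using xe we by simp
  have x_in: "x \<in> complex_vector.span {x, y}" and y_in: "y \<in> complex_vector.span {x, y}"
    by (auto intro: complex_vector.span_base)
  have "w \<in> complex_vector.span {x, y}"
    unfolding w_def
    by (intro complex_vector.span_diff complex_vector.span_scale x_in y_in)
  then have "b - e \<in> complex_vector.span {x, y}"
    unfolding e_def
    by (auto intro: complex_vector.span_add complex_vector.span_scale x_in)
  with b have "e \<noteq> 0"
    by auto
  with xe ye that show thesis by blast
qed

section \<open>Compact antilinear operators\<close>

locale compact_antilinear =
  fixes A :: "'a :: complex_hilbert \<Rightarrow> 'a"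
  assumes antilinear: "antilinear A"
    and compact: "compact_operator A"
begin

sublocale A: linear A
  using antilinear by (simp add: antilinear_def)

lemma A_scaleC: "A (c *\<^sub>C x) = cnj c *\<^sub>C A x"
proof -
  have i: "A (\<i> *\<^sub>C v) = - (\<i> *\<^sub>C A v)" for v
    using antilinear by (simp add: antilinear_def)
  have "c *\<^sub>C x = Re c *\<^sub>R x + \<i> *\<^sub>C (Im c *\<^sub>R x)"
    by (simp add: scaleR_scaleC scaleC_scaleC scaleC_add_left[symmetric] complex_eq[symmetric])
  then have "A (c *\<^sub>C x) = Re c *\<^sub>R A x + - (\<i> *\<^sub>C (Im c *\<^sub>R A x))"
    by (simp add: A.add A.scale i)
  also have "\<dots> = (complex_of_real (Re c) + - (\<i> * complex_of_real (Im c))) *\<^sub>C A x"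
    by (simp only: scaleR_scaleC scaleC_scaleC scaleC_add_left complex_vector.scale_minus_left)
  also have "complex_of_real (Re c) + - (\<i> * complex_of_real (Im c)) = cnj c"
    by (simp add: complex_eq_iff)
  finally show ?thesis .
qed

lemma bounded_linear_A: "bounded_linear A"
proof -
  have "bounded (closure (A ` cball 0 1))"
    using compact bounded_cball by (auto simp: compact_operator_def intro: compact_imp_bounded)
  then have "bounded (A ` cball 0 1)"
    using bounded_subset closure_subset by blast
  then obtain b where b: "\<forall>x\<in>cball 0 1. norm (A x) \<le> b"
    by (auto simp: bounded_iff)
  have "norm (A x) \<le> norm x * b" for x
  proof (cases "x = 0")
    case False
    then have "norm (A (x /\<^sub>R norm x)) \<le> b"
      by (intro b[rule_format]) simp
    with False show ?thesis
      by (simp add: A.scale field_simps)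
  qed (simp add: A.zero)
  then show ?thesis
    by (intro bounded_linear_intro[where K = b]) (auto simp: A.add A.scale)
qed

text \<open>
  The square of \<open>A\<close> is complex linear, so the spectral arguments are carried out for it.
\<close>

definition K :: "'a \<Rightarrow> 'a" where
  "K x = A (A x)"

lemma bounded_linear_K: "bounded_linear K"
  using bounded_linear_compose[OF bounded_linear_A bounded_linear_A] by (simp add: K_def[abs_def])

sublocale K: bounded_linear K
  by (rule bounded_linear_K)

lemma K_scaleC: "K (c *\<^sub>C x) = c *\<^sub>C K x"
  by (simp add: K_def A_scaleC)

lemma convergent_subsequence_K:
  fixes x :: "nat \<Rightarrow> 'a"
  assumes "bounded (range x)"
  obtains l r where "strict_mono r" "(\<lambda>n. K (x (r n))) \<longlonglongrightarrow> l"
proof -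
  from compact assms have "compact (closure (A ` range x))"
    unfolding compact_operator_def by blast
  then have "seq_compact (closure (A ` range x))"
    by (rule compact_imp_seq_compact)
  moreover have "\<forall>n. A (x n) \<in> closure (A ` range x)"
    by (auto intro: closure_subset[THEN subsetD])
  ultimately obtain l r where r: "strict_mono r" and "((\<lambda>n. A (x n)) \<circ> r) \<longlonglongrightarrow> l"
    by (rule seq_compactE) blast
  then have "(\<lambda>n. A (A (x (r n)))) \<longlonglongrightarrow> A l"
    by (auto simp: o_def intro: bounded_linear.tendsto[OF bounded_linear_A])
  with r show thesis
    by (auto simp: K_def intro: that)
qed

text \<open>
  If the bound failed, there would be unit vectors \<open>x n\<close> and scalars \<open>s n\<close> in a disc with
  \<open>x n - s n *\<^sub>C K (x n)\<close> tending to \<open>0\<close>. Along a subsequence \<open>s n\<close> converges to some \<open>t\<close> and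
  \<open>K (x n)\<close> to some \<open>l\<close>, hence \<open>x n\<close> to \<open>t *\<^sub>C l\<close>, a unit vector annihilated by \<open>I - t K\<close>. The bound
  has to be uniform in \<open>s\<close> because Cauchy's inequality needs the resolvent bounded on circles.
\<close>

lemma uniformly_bounded_below:
  assumes inj: "\<And>s x. x = s *\<^sub>C K x \<Longrightarrow> x = 0"
  obtains d where "d > 0" "\<And>s x. cmod s \<le> r \<Longrightarrow> d * norm x \<le> norm (x - s *\<^sub>C K x)"
proof (rule ccontr)
  assume "\<not> thesis"
  with that have no: "\<exists>s x. cmod s \<le> r \<and> norm (x - s *\<^sub>C K x) < d * norm x" if "d > 0" for d
    using \<open>d > 0\<close> by (meson not_le)
  have "\<exists>s x. cmod s \<le> r \<and> norm x = 1 \<and> norm (x - s *\<^sub>C K x) < 1 / real (Suc n)" for n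
  proof -
    obtain s x where s: "cmod s \<le> r" and x: "norm (x - s *\<^sub>C K x) < 1 / real (Suc n) * norm x"
      using no[of "1 / real (Suc n)"] by auto
    then have "x \<noteq> 0"
      by auto
    define y where "y = x /\<^sub>R norm x"
    have "y - s *\<^sub>C K y = (x - s *\<^sub>C K x) /\<^sub>R norm x"
      by (simp add: y_def K.scaleR scaleR_diff_right
          bounded_bilinear.scaleR_right[OF bounded_bilinear_scaleC])
    then have "norm (y - s *\<^sub>C K y) < 1 / real (Suc n)"
      using x \<open>x \<noteq> 0\<close> by (simp add: pos_divide_less_eq flip: divide_inverse_commute)
    moreover have "norm y = 1"
      using \<open>x \<noteq> 0\<close> by (simp add: y_def)
    ultimately show ?thesis
      using s by blast
  qed
  then obtain s x where s: "\<And>n. cmod (s n) \<le> r" and x: "\<And>n. norm (x n) = 1"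
    and lim: "\<And>n. norm (x n - s n *\<^sub>C K (x n)) < 1 / real (Suc n)"
    by metis
  have "bounded (range x)"
    using x by (auto simp: bounded_iff)
  then obtain l p where p: "strict_mono p" and l: "(\<lambda>n. K (x (p n))) \<longlonglongrightarrow> l"
    using convergent_subsequence_K by blast
  have "seq_compact (cball (0 :: complex) r)"
    using compact_cball compact_imp_seq_compact by blast
  moreover have "\<forall>n. s (p n) \<in> cball 0 r"
    using s by simp
  ultimately obtain t q where q: "strict_mono q" and t: "((\<lambda>n. s (p n)) \<circ> q) \<longlonglongrightarrow> t"
    by (rule seq_compactE) blast
  define u where "u n = x (p (q n))" for n
  have Ku: "(\<lambda>n. K (u n)) \<longlonglongrightarrow> l"
    using LIMSEQ_subseq_LIMSEQ[OF l q] by (simp add: u_def o_def)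
  have "(\<lambda>n. x n - s n *\<^sub>C K (x n)) \<longlonglongrightarrow> 0"
    by (rule LIMSEQ_norm_0) (rule lim)
  then have "(\<lambda>n. x (p (q n)) - s (p (q n)) *\<^sub>C K (x (p (q n)))) \<longlonglongrightarrow> 0"
    using LIMSEQ_subseq_LIMSEQ[OF _ strict_mono_o[OF p q]] by (fastforce simp: o_def)
  moreover have "(\<lambda>n. s (p (q n)) *\<^sub>C K (u n)) \<longlonglongrightarrow> t *\<^sub>C l"
    using t by (intro bounded_bilinear.tendsto[OF bounded_bilinear_scaleC] Ku) (simp add: o_def)
  ultimately have u: "u \<longlonglongrightarrow> t *\<^sub>C l"
    unfolding u_def using tendsto_add by fastforce
  have "K (t *\<^sub>C l) = l"
    using LIMSEQ_unique[OF K.tendsto[OF u] Ku] .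
  then have "t *\<^sub>C l = 0"
    using inj[of "t *\<^sub>C l" t] by simp
  moreover have "norm (t *\<^sub>C l) = 1"
    using LIMSEQ_unique[OF tendsto_norm[OF u], of 1] x by (simp add: u_def)
  ultimately show False
    by (simp del: complex_vector.scale_eq_0_iff)
qed

lemma A_closure:
  assumes "A ` S \<subseteq> S"
  shows "A ` closure S \<subseteq> closure S"
  using assms closure_subset
  by (intro image_closure_subset linear_continuous_on bounded_linear_A) auto

end

section \<open>Compact antilinear operators without invariant subspaces\<close>

locale transitive_compact_antilinear = compact_antilinear +
  assumes nonzero: "A \<noteq> (\<lambda>x. 0)"
    and three_independent: "\<exists>B :: 'a set. card B = 3 \<and> cindependent B"
    and transitive: "\<And>M. csubspace M \<Longrightarrow> closed M \<Longrightarrow> A ` M \<subseteq> M \<Longrightarrow> M = {0} \<or> M = UNIV"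
begin

lemma invariant_dense:
  assumes "csubspace S" "A ` S \<subseteq> S" "x \<in> S" "x \<noteq> 0"
  shows "closure S = UNIV"
  using transitive[OF closure_csubspace closed_closure A_closure, of S] assms closure_subset[of S]
  by blast

text \<open>
  If \<open>K x\<close> is a multiple of \<open>x\<close>, then \<open>A\<close> exchanges \<open>x\<close> and \<open>A x\<close> up to scalars, so their span is
  invariant. A vector orthogonal to both is orthogonal to the closure of the span too, which
  therefore is not the whole space.
\<close>

lemma no_eigenvector_K:
  assumes "K x = m *\<^sub>C x"
  shows "x = 0"
proof (rule ccontr)
  assume "x \<noteq> 0"
  define S where "S = complex_vector.span {x, A x}"
  have in_S: "x \<in> S" "A x \<in> S"
    by (auto simp: S_def intro: complex_vector.span_base)
  have S: "csubspace S"
    by (simp add: S_def complex_vector.subspace_span)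
  have "A v \<in> S" if "v \<in> S" for v
    using that unfolding S_def
  proof (rule complex_vector.span_induct)
    show "csubspace {v. A v \<in> complex_vector.span {x, A x}}"
      by (rule complex_vector.subspaceI)
        (auto simp: A.zero A.add A_scaleC intro: complex_vector.span_zero
          complex_vector.span_add complex_vector.span_scale)
    show "A v \<in> complex_vector.span {x, A x}" if "v \<in> {x, A x}" for v
      using that in_S assms by (auto simp: S_def K_def intro: complex_vector.span_scale)
  qed
  then have dense: "closure S = UNIV"
    using invariant_dense[OF S _ in_S(1) \<open>x \<noteq> 0\<close>] by blast
  have "S \<noteq> UNIV"
  proof
    assume "S = UNIV"
    obtain B :: "'a set" where B: "card B = 3" "cindependent B"
      using three_independent by blast
    then have "card B \<le> card {x, A x}"
      using complex_vector.independent_span_bound[of "{x, A x}" B] \<open>S = UNIV\<close> by (simp add: S_def)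
    also have "\<dots> \<le> 2"
      by (simp add: card_insert_if)
    finally show False
      using B by simp
  qed
  then obtain e where e: "e \<noteq> 0" "cinner x e = 0" "cinner (A x) e = 0"
    using exists_orthogonal_to_pair[of _ x "A x"] by (auto simp: S_def)
  have "cinner v e = 0" if "v \<in> S" for v
    using that unfolding S_def
  proof (rule complex_vector.span_induct)
    show "csubspace {v. cinner v e = 0}"
      by (rule complex_vector.subspaceI)
        (auto simp: cinner_add_left cinner_scaleC_left
          linear_0[OF bounded_linear.linear[OF bounded_linear_cinner_left]])
  qed (use e in auto)
  moreover have "closed ((\<lambda>v. cinner v e) -` {0})"
    by (intro closed_vimage closed_singleton linear_continuous_on bounded_linear_cinner_left)
  ultimately have "closure S \<subseteq> (\<lambda>v. cinner v e) -` {0}"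
    by (intro closure_minimal) auto
  then have "cinner e e = 0"
    using dense by blast
  with e show False
    by (simp add: cinner_eq_zero_iff)
qed

section \<open>The resolvent of the square\<close>

definition W :: "complex \<Rightarrow> 'a \<Rightarrow> 'a" where
  "W s x = x - s *\<^sub>C K x"

lemma trivial_kernel_W: "x = s *\<^sub>C K x \<Longrightarrow> x = 0"
proof (cases "s = 0")
  case False
  assume "x = s *\<^sub>C K x"
  then have "K x = (1 / s) *\<^sub>C x"
    using False by (metis complex_vector.scale_one complex_vector.scale_scale divide_self_if
        times_divide_eq_left mult_1)
  then show "x = 0"
    by (rule no_eigenvector_K)
qed simp

lemma W_bounded_below:
  obtains d where "d > 0" "\<And>s x. cmod s \<le> r \<Longrightarrow> d * norm x \<le> norm (W s x)"
  by (rule uniformly_bounded_below[of r]) (use trivial_kernel_W that in \<open>auto simp: W_def\<close>)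

lemma W_add: "W s (x + y) = W s x + W s y"
  by (simp add: W_def K.add scaleC_add_right)

lemma W_scaleC: "W s (c *\<^sub>C x) = c *\<^sub>C W s x"
  by (simp add: W_def K_scaleC complex_vector.scale_right_diff_distrib mult.commute)

lemma W_diff: "W s (x - y) = W s x - W s y"
  by (simp add: W_def K.diff complex_vector.scale_right_diff_distrib)

lemma bounded_linear_W: "bounded_linear (W s)"
  unfolding W_def[abs_def]
  by (rule bounded_linear_sub[OF bounded_linear_ident bounded_linear_compose[
        OF bounded_bilinear.bounded_linear_right[OF bounded_bilinear_scaleC] bounded_linear_K]])

lemma W_commute: "W s (W t x) = W t (W s x)"
  by (simp add: W_def K.diff K_scaleC complex_vector.scale_right_diff_distrib mult.commute)

text \<open>
  Antilinearity conjugates the parameter. This is why \<open>W s\<close> has to be paired with \<open>W (cnj s)\<close> to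
  obtain an \<open>A\<close>-invariant range.
\<close>

lemma A_W: "A (W s x) = W (cnj s) (A x)"
  by (simp add: W_def K_def A.diff A_scaleC)

lemma inj_W: "inj (W s)"
proof (rule injI)
  fix x y assume "W s x = W s y"
  then have "W s (x - y) = 0"
    by (simp add: W_diff)
  then show "x = y"
    using trivial_kernel_W[of "x - y" s] by (simp add: W_def)
qed

text \<open>
  The range of \<open>W s \<circ> W (cnj s)\<close> is closed because both factors are bounded below, and invariant
  because \<open>A\<close> only swaps the two commuting factors. As it is not zero, it is everything.
\<close>

lemma surj_W: "surj (W s)"
proof -
  define Q where "Q = W s \<circ> W (cnj s)"
  have Q: "bounded_linear Q"
    unfolding Q_def comp_def by (rule bounded_linear_compose[OF bounded_linear_W bounded_linear_W])
  obtain d where d: "d > 0" "\<And>t x. cmod t \<le> cmod s \<Longrightarrow> d * norm x \<le> norm (W t x)"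
    using W_bounded_below[of "cmod s"] by blast
  have "d * d * norm x \<le> norm (Q x)" for x
  proof -
    have "d * (d * norm x) \<le> d * norm (W (cnj s) x)"
      using d by (intro mult_left_mono) auto
    also have "\<dots> \<le> norm (Q x)"
      using d by (simp add: Q_def)
    finally show ?thesis
      by (simp add: mult.assoc)
  qed
  then have "closed (range Q)"
    using d Q by (intro complete_imp_closed complete_isometric_image[of "d * d"])
      (auto simp: complete_UNIV)
  moreover have "csubspace (range Q)"
  proof (rule complex_vector.subspaceI)
    show "0 \<in> range Q"
      using linear_0[OF bounded_linear.linear[OF Q]] by (metis rangeI)
    show "x + y \<in> range Q" if "x \<in> range Q" "y \<in> range Q" for x y
      using that by (auto simp: Q_def W_add[symmetric])
    show "c *\<^sub>C x \<in> range Q" if "x \<in> range Q" for c x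
      using that by (auto simp: Q_def W_scaleC[symmetric])
  qed
  moreover have "A ` range Q \<subseteq> range Q"
    using W_commute by (auto simp: Q_def A_W)
  moreover have "range Q \<noteq> {0}"
  proof
    assume zero: "range Q = {0}"
    have "inj Q"
      unfolding Q_def by (intro inj_compose inj_W)
    moreover have "Q x = Q 0" for x
      using zero by (metis rangeI singletonD)
    ultimately have "x = 0" for x :: 'a
      using injD[of Q x 0] by simp
    then have "A x = 0" for x
      by (metis A.zero)
    with nonzero show False
      by (simp add: fun_eq_iff)
  qed
  ultimately have "range Q = UNIV"
    using transitive[of "range Q"] by simp
  then have "\<exists>z. x = W s (W (cnj s) z)" for x
    unfolding Q_def comp_def by (rule surjD)
  then show ?thesis
    unfolding surj_def by blast
qed

definition R :: "complex \<Rightarrow> 'a \<Rightarrow> 'a" where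
  "R s = inv (W s)"

lemma W_R [simp]: "W s (R s x) = x"
  by (simp add: R_def surj_W surj_f_inv_f)

lemma R_eqI: "W s y = x \<Longrightarrow> R s x = y"
  using inj_W[of s] by (auto simp: R_def)

lemma R_bounded:
  obtains C where "C > 0" "\<And>s x. cmod s \<le> r \<Longrightarrow> norm (R s x) \<le> C * norm x"
proof -
  obtain d where d: "d > 0" "\<And>s x. cmod s \<le> r \<Longrightarrow> d * norm x \<le> norm (W s x)"
    using W_bounded_below[of r] by blast
  have "norm (R s x) \<le> 1 / d * norm x" if "cmod s \<le> r" for s x
    using d(2)[OF that, of "R s x"] d(1) by (simp add: field_simps)
  with d(1) show thesis
    by (intro that[of "1 / d"]) auto
qed

lemma resolvent_identity: "R s x = R t x + (s - t) *\<^sub>C R s (K (R t x))"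
proof (rule R_eqI)
  have "W s (R t x) = W t (R t x) - (s - t) *\<^sub>C K (R t x)"
    by (simp only: W_def complex_vector.scale_left_diff_distrib) simp
  then show "W s (R t x + (s - t) *\<^sub>C R s (K (R t x))) = x"
    by (simp add: W_add W_scaleC)
qed

lemma continuous_R: "((\<lambda>s. R s x) \<longlongrightarrow> R t x) (at t)"
proof -
  obtain C where C: "\<And>s x. cmod s \<le> cmod t + 1 \<Longrightarrow> norm (R s x) \<le> C * norm x"
    using R_bounded[of "cmod t + 1"] by blast
  define c where "c = C * norm (K (R t x))"
  have "\<forall>\<^sub>F s in at t. dist s t < 1"
    by (auto simp: eventually_at intro!: exI[of _ 1])
  then have "\<forall>\<^sub>F s in at t. norm (R s x - R t x) \<le> cmod (s - t) * c"
  proof eventually_elim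
    case (elim s)
    then have "cmod s \<le> cmod t + 1"
      using norm_triangle_ineq2[of s t] by (simp add: dist_norm)
    then show ?case
      using C[of s "K (R t x)"] resolvent_identity[of s x t]
      by (simp add: c_def norm_scaleC mult_left_mono)
  qed
  moreover have "((\<lambda>s. cmod (s - t) * c) \<longlongrightarrow> 0) (at t)"
    by (auto intro!: tendsto_eq_intros)
  ultimately have "((\<lambda>s. R s x - R t x) \<longlongrightarrow> 0) (at t)"
    by (rule Lim_null_comparison)
  then show ?thesis
    by (simp add: LIM_zero_iff)
qed

lemma holomorphic_resolvent: "(\<lambda>s. cinner (R s x) y) holomorphic_on S"
proof -
  have "((\<lambda>s. cinner (R s x) y) has_field_derivative cinner (R t (K (R t x))) y) (at t)" for t
    unfolding has_field_derivative_iff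
  proof (rule Lim_transform_eventually)
    show "((\<lambda>s. cinner (R s (K (R t x))) y) \<longlongrightarrow> cinner (R t (K (R t x))) y) (at t)"
      by (rule bounded_linear.tendsto[OF bounded_linear_cinner_left continuous_R])
    have "cinner (R s (K (R t x))) y = (cinner (R s x) y - cinner (R t x) y) / (s - t)"
      if "s \<noteq> t" for s
      using that resolvent_identity[of s x t] by (simp add: cinner_add_left cinner_scaleC_left)
    then show "\<forall>\<^sub>F s in at t. cinner (R s (K (R t x))) y
        = (cinner (R s x) y - cinner (R t x) y) / (s - t)"
      by (simp add: eventually_at_filter)
  qed
  then show ?thesis
    by (auto simp: holomorphic_on_def field_differentiable_def intro: has_field_derivative_at_within)
qed

text \<open>
  The Neumann series truncated after \<open>n\<close> terms, with its exact remainder.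
\<close>

lemma R_expansion: "R s x = (\<Sum>j<n. s ^ j *\<^sub>C (K ^^ j) x) + s ^ n *\<^sub>C R s ((K ^^ n) x)"
proof (induction n)
  case (Suc n)
  have "R s v = v + s *\<^sub>C R s (K v)" for v
    by (rule R_eqI) (simp add: W_add W_scaleC, simp add: W_def)
  from this[of "(K ^^ n) x"] have
    "s ^ n *\<^sub>C R s ((K ^^ n) x) = s ^ n *\<^sub>C (K ^^ n) x + s ^ Suc n *\<^sub>C R s ((K ^^ Suc n) x)"
    by (simp add: scaleC_add_right scaleC_scaleC mult.commute)
  with Suc show ?case
    by simp
qed simp

lemma resolvent_has_fps_expansion:
  "(\<lambda>s. cinner (R s x) y) has_fps_expansion Abs_fps (\<lambda>n. cinner ((K ^^ n) x) y)"
proof (rule has_fps_expansionI)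
  obtain C where C: "C > 0" "\<And>s x. cmod s \<le> 1 \<Longrightarrow> norm (R s x) \<le> C * norm x"
    using R_bounded[of 1] by blast
  obtain k where k: "k > 0" "\<And>x. norm (K x) \<le> k * norm x"
    using K.pos_bounded by (metis mult.commute)
  have Kn: "norm ((K ^^ n) x) \<le> k ^ n * norm x" for n
  proof (induction n)
    case (Suc n)
    have "norm ((K ^^ Suc n) x) \<le> k * norm ((K ^^ n) x)"
      using k(2) by simp
    also have "\<dots> \<le> k * (k ^ n * norm x)"
      using Suc k(1) by (intro mult_left_mono) auto
    finally show ?case
      by (simp add: mult.assoc)
  qed simp
  have sums: "(\<lambda>n. cinner ((K ^^ n) x) y * s ^ n) sums cinner (R s x) y"
    if s: "cmod s < min 1 (1 / k)" for s
    unfolding sums_def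
  proof (rule LIM_zero_cancel, rule Lim_null_comparison)
    have "cmod s * k < 1"
      using s k(1) by (simp add: field_simps)
    then show "(\<lambda>n. (cmod s * k) ^ n * (C * norm x * norm y)) \<longlonglongrightarrow> 0"
      using k(1) by (intro tendsto_mult_left_zero LIMSEQ_power_zero) simp
    have "cmod (cinner (R s x) y - (\<Sum>j<n. cinner ((K ^^ j) x) y * s ^ j))
        \<le> (cmod s * k) ^ n * (C * norm x * norm y)" for n
    proof -
      interpret ip: bounded_linear "\<lambda>v. cinner v y"
        by (rule bounded_linear_cinner_left)
      have "cinner (R s x) y - (\<Sum>j<n. cinner ((K ^^ j) x) y * s ^ j)
          = s ^ n * cinner (R s ((K ^^ n) x)) y"
        by (subst R_expansion[of s x n])
          (simp add: ip.add ip.sum cinner_scaleC_left mult.commute)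
      also have "cmod \<dots> \<le> cmod s ^ n * (norm (R s ((K ^^ n) x)) * norm y)"
        by (simp add: norm_mult norm_power mult_left_mono norm_cinner_le)
      also have "\<dots> \<le> cmod s ^ n * ((C * (k ^ n * norm x)) * norm y)"
        using C s Kn[of n] by (intro mult_left_mono mult_right_mono order.trans[OF C(2)]) auto
      finally show ?thesis
        by (simp add: power_mult_distrib mult_ac)
    qed
    then show "\<forall>\<^sub>F n in sequentially. cmod ((\<Sum>j<n. cinner ((K ^^ j) x) y * s ^ j) - cinner (R s x) y)
        \<le> (cmod s * k) ^ n * (C * norm x * norm y)"
      by (intro always_eventually allI) (simp add: norm_minus_commute)
  qed
  show "\<forall>\<^sub>F s in nhds 0. (\<lambda>n. fps_nth (Abs_fps (\<lambda>n. cinner ((K ^^ n) x) y)) n * s ^ n) sums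
      cinner (R s x) y"
    unfolding eventually_nhds_metric using sums k(1)
    by (intro exI[of _ "min 1 (1 / k)"]) auto
qed

text \<open>
  The \<open>n\<close>-th Taylor coefficient at \<open>0\<close> of \<open>\<lambda>s. cinner (R s x) y\<close> is \<open>cinner ((K ^^ n) x) y\<close>. With
  \<open>y = (K ^^ n) x\<close> it equals \<open>(norm y)\<^sup>2\<close>, while Cauchy's inequality on the circle of radius \<open>r\<close> bounds
  it by a multiple of \<open>norm y / r ^ n\<close>; one factor \<open>norm y\<close> cancels.
\<close>

lemma K_power_decay:
  assumes "r > 0"
  obtains C where "\<And>n. norm ((K ^^ n) x) \<le> C / r ^ n"
proof -
  obtain C where C: "C > 0" "\<And>s x. cmod s \<le> r \<Longrightarrow> norm (R s x) \<le> C * norm x"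
    using R_bounded[of r] by blast
  have "norm ((K ^^ n) x) \<le> C * norm x / r ^ n" for n
  proof -
    define y where "y = (K ^^ n) x"
    define f where "f s = cinner (R s x) y" for s
    have hol: "f holomorphic_on S" for S
      unfolding f_def by (rule holomorphic_resolvent)
    have bound: "cmod (f s) \<le> C * norm x * norm y" if "norm (0 - s) = r" for s
    proof -
      have "cmod (f s) \<le> norm (R s x) * norm y"
        by (simp add: f_def norm_cinner_le)
      also have "\<dots> \<le> C * norm x * norm y"
        using C(2)[of s x] that by (intro mult_right_mono) auto
      finally show ?thesis .
    qed
    have deriv: "cmod ((deriv ^^ n) f 0) \<le> fact n * (C * norm x * norm y) / r ^ n"
      using hol holomorphic_on_imp_continuous_on assms bound by (intro Cauchy_inequality) auto
    have "cinner y y = (deriv ^^ n) f 0 / fact n"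
      using fps_nth_fps_expansion[OF resolvent_has_fps_expansion[of x y], of n]
      by (simp add: y_def f_def[abs_def])
    then have norm_y: "(norm y)\<^sup>2 = cmod ((deriv ^^ n) f 0) / fact n"
      by (metis cinner_self norm_divide norm_fact norm_of_real abs_of_nonneg zero_le_power2)
    have "(norm y)\<^sup>2 \<le> (fact n * (C * norm x * norm y) / r ^ n) / fact n"
      unfolding norm_y by (intro divide_right_mono deriv) auto
    then have "norm y * norm y \<le> (C * norm x / r ^ n) * norm y"
      by (simp add: power2_eq_square)
    then show ?thesis
      using C(1) assms mult_right_le_imp_le[of "norm y" "norm y" "C * norm x / r ^ n"]
      by (cases "y = 0") (simp_all flip: y_def)
  qed
  then show thesis
    by (rule that)
qed

section \<open>Tempered operators and their orbits\<close>

text \<open>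
  Hilden's argument for a linear operator moves powers of it past operators that commute with it.
  A complex polynomial \<open>P\<close> in \<open>A\<close> need not commute with \<open>A\<close>, as moving \<open>A\<close> past it conjugates the
  coefficients. What survives is the norm estimate below, with a constant independent of \<open>k\<close>.
\<close>

definition controlled :: "('a \<Rightarrow> 'a) \<Rightarrow> real \<Rightarrow> bool" where
  "controlled P c \<longleftrightarrow> c \<ge> 0 \<and> (\<forall>k x. norm ((A ^^ k) (P x)) \<le> c * norm ((A ^^ k) x))"

definition tempered :: "('a \<Rightarrow> 'a) set" where
  "tempered = {P. linear P \<and> (\<exists>c. controlled P c)}"

lemma A_power_linear: "linear (A ^^ k)"
  by (induction k) (auto simp: linear_iff A.add A.scale)

lemma A_power_scaleC: "norm ((A ^^ k) (c *\<^sub>C x)) = cmod c * norm ((A ^^ k) x)"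
proof -
  have "\<exists>d. cmod d = cmod c \<and> (A ^^ k) (c *\<^sub>C x) = d *\<^sub>C (A ^^ k) x"
  proof (induction k)
    case (Suc k)
    then obtain d where "cmod d = cmod c" "(A ^^ k) (c *\<^sub>C x) = d *\<^sub>C (A ^^ k) x"
      by blast
    then show ?case
      by (intro exI[of _ "cnj d"]) (simp add: A_scaleC)
  qed auto
  then show ?thesis
    by (auto simp: norm_scaleC)
qed

text \<open>
  The estimate defining tempered operators is preserved by sums, by complex multiples (only the
  modulus of the scalar enters) and by composition with \<open>A\<close> on the left, which costs a factor equal
  to a bound of \<open>A\<close>. So the orbit of \<open>y\<close> is an \<open>A\<close>-invariant complex subspace containing \<open>y\<close>.
\<close>

lemma orbit_dense:
  assumes "y \<noteq> 0"
  shows "closure ((\<lambda>P. P y) ` tempered) = UNIV"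
proof (rule invariant_dense[OF _ _ _ assms])
  show "csubspace ((\<lambda>P. P y) ` tempered)"
  proof (rule complex_vector.subspaceI)
    have "(\<lambda>x. 0) \<in> tempered"
      by (auto simp: tempered_def controlled_def linear_iff linear_0[OF A_power_linear]
          intro!: exI[of _ 0])
    then show "0 \<in> (\<lambda>P. P y) ` tempered"
      by force
    have "(\<lambda>x. P x + Q x) \<in> tempered" if PQ: "P \<in> tempered" "Q \<in> tempered" for P Q
    proof -
      obtain c d where cd: "controlled P c" "controlled Q d"
        using PQ unfolding tempered_def by blast
      have "controlled (\<lambda>x. P x + Q x) (c + d)"
        unfolding controlled_def
      proof (intro conjI allI)
        fix k x
        have "norm ((A ^^ k) (P x + Q x)) \<le> norm ((A ^^ k) (P x)) + norm ((A ^^ k) (Q x))"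
          by (simp add: linear_add[OF A_power_linear] norm_triangle_ineq)
        also have "\<dots> \<le> c * norm ((A ^^ k) x) + d * norm ((A ^^ k) x)"
          using cd by (intro add_mono) (auto simp: controlled_def)
        finally show "norm ((A ^^ k) (P x + Q x)) \<le> (c + d) * norm ((A ^^ k) x)"
          by (simp add: distrib_right)
      qed (use cd in \<open>auto simp: controlled_def\<close>)
      then show ?thesis
        using PQ by (auto simp: tempered_def intro: linear_compose_add)
    qed
    then show "u + v \<in> (\<lambda>P. P y) ` tempered"
      if "u \<in> (\<lambda>P. P y) ` tempered" "v \<in> (\<lambda>P. P y) ` tempered" for u v
      using that by (auto intro: image_eqI[of _ _ "\<lambda>x. _ x + _ x"])
    have "(\<lambda>x. a *\<^sub>C P x) \<in> tempered" if P: "P \<in> tempered" for a P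
    proof -
      obtain c where c: "controlled P c"
        using P by (auto simp: tempered_def)
      have "controlled (\<lambda>x. a *\<^sub>C P x) (cmod a * c)"
        using c by (auto simp: controlled_def A_power_scaleC mult.assoc mult_left_mono)
      moreover have "linear (\<lambda>x. a *\<^sub>C P x)"
        using P by (auto simp: tempered_def linear_iff scaleC_add_right
            bounded_bilinear.scaleR_right[OF bounded_bilinear_scaleC])
      ultimately show ?thesis
        by (auto simp: tempered_def)
    qed
    then show "a *\<^sub>C u \<in> (\<lambda>P. P y) ` tempered" if "u \<in> (\<lambda>P. P y) ` tempered" for a u
      using that by (auto intro: image_eqI[of _ _ "\<lambda>x. _ *\<^sub>C _ x"])
  qed
  have "(\<lambda>x. A (P x)) \<in> tempered" if P: "P \<in> tempered" for P
  proof -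
    obtain c where c: "controlled P c"
      using P by (auto simp: tempered_def)
    obtain b where b: "b > 0" "\<And>x. norm (A x) \<le> b * norm x"
      using bounded_linear.pos_bounded[OF bounded_linear_A] by (metis mult.commute)
    have "controlled (\<lambda>x. A (P x)) (b * c)"
      unfolding controlled_def
    proof (intro conjI allI)
      fix k x
      have "norm ((A ^^ k) (A (P x))) = norm (A ((A ^^ k) (P x)))"
        by (simp add: funpow_swap1)
      also have "\<dots> \<le> b * norm ((A ^^ k) (P x))"
        by (rule b)
      also have "\<dots> \<le> b * (c * norm ((A ^^ k) x))"
        using b c by (intro mult_left_mono) (auto simp: controlled_def)
      finally show "norm ((A ^^ k) (A (P x))) \<le> b * c * norm ((A ^^ k) x)"
        by (simp add: mult.assoc)
    qed (use b c in \<open>auto simp: controlled_def\<close>)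
    moreover have "linear (\<lambda>x. A (P x))"
      using P by (auto simp: tempered_def linear_iff A.add A.scale)
    ultimately show ?thesis
      by (auto simp: tempered_def)
  qed
  then show "A ` (\<lambda>P. P y) ` tempered \<subseteq> (\<lambda>P. P y) ` tempered"
    by (auto intro: image_eqI[of _ _ "\<lambda>x. A (_ x)"])
  have "(\<lambda>x. x) \<in> tempered"
    by (auto simp: tempered_def controlled_def linear_ident intro!: exI[of _ 1])
  then show "y \<in> (\<lambda>P. P y) ` tempered"
    by force
qed

lemma continuous_tempered:
  assumes "P \<in> tempered"
  shows "continuous_on S P"
proof -
  obtain c where "controlled P c" "linear P"
    using assms by (auto simp: tempered_def)
  then have "norm ((A ^^ 0) (P x)) \<le> c * norm ((A ^^ 0) x)" for x
    unfolding controlled_def by blast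
  then have "norm (P x) \<le> norm x * c" for x
    by (simp add: mult.commute)
  with \<open>linear P\<close> have "bounded_linear P"
    by (intro bounded_linear_intro[where K = c]) (auto simp: linear_add linear_scale)
  then show ?thesis
    by (rule linear_continuous_on)
qed

section \<open>The contradiction\<close>

lemma contradiction: False
proof -
  obtain v where v: "A v \<noteq> 0"
    using nonzero by blast
  obtain b where b: "b > 0" "\<And>x. norm (A x) \<le> b * norm x"
    using bounded_linear.pos_bounded[OF bounded_linear_A] by (metis mult.commute)
  \<comment> \<open>With this length of \<open>z\<close>, no point of the unit ball around it is mapped closer to \<open>0\<close> than \<open>b\<close>.\<close>
  define z where "z = (2 * b / norm (A v)) *\<^sub>R v"
  have Az: "norm (A z) = 2 * b"
    using v b by (simp add: z_def A.scale)
  define B where "B = ball z 1"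
  have A_B: "norm (A x) \<ge> b" if "x \<in> B" for x
  proof -
    have "norm (A z) - norm (A x) \<le> norm (A (z - x))"
      by (simp add: A.diff norm_triangle_ineq2)
    also have "\<dots> \<le> b * norm (z - x)"
      by (rule b)
    also have "\<dots> \<le> b"
      using that b(1) by (simp add: B_def dist_norm)
    finally show ?thesis
      using Az by simp
  qed
  have cpt: "compact (closure (A ` B))"
    using compact by (simp add: compact_operator_def B_def)
  have "closed {x :: 'a. b \<le> norm x}"
    by (intro closed_Collect_le continuous_intros)
  then have "closure (A ` B) \<subseteq> {x. b \<le> norm x}"
    using A_B by (intro closure_minimal) auto
  then have nz: "0 \<notin> closure (A ` B)"
    using b(1) by auto
  have "\<exists>P\<in>tempered. P y \<in> B" if "y \<in> closure (A ` B)" for y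
  proof -
    have "closure ((\<lambda>P. P y) ` tempered) = UNIV"
      using nz that by (intro orbit_dense) auto
    moreover have "open B" "z \<in> B"
      by (auto simp: B_def)
    ultimately show ?thesis
      using open_Int_closure_eq_empty[of B "(\<lambda>P. P y) ` tempered"] by auto
  qed
  then have cover: "closure (A ` B) \<subseteq> (\<Union>P\<in>tempered. P -` B)"
    by auto
  have "open (P -` B)" if "P \<in> tempered" for P
    using continuous_tempered[OF that] by (simp add: open_vimage B_def)
  then obtain D where D: "D \<subseteq> tempered" "finite D" "closure (A ` B) \<subseteq> (\<Union>P\<in>D. P -` B)"
    using compactE_image[OF cpt _ cover] by metis
  then have "\<forall>P\<in>D. \<exists>c. controlled P c"
    by (auto simp: tempered_def)
  then obtain d where d: "\<And>P. P \<in> D \<Longrightarrow> controlled P (d P)"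
    by metis
  \<comment> \<open>A common bound of the finitely many constants; the summand 1 makes it positive when \<open>D\<close> is empty.\<close>
  define c where "c = 1 + (\<Sum>P\<in>D. d P)"
  have d_nonneg: "d P \<ge> 0" if "P \<in> D" for P
    using d[OF that] by (simp add: controlled_def)
  have c: "d P \<le> c" if "P \<in> D" for P
    using member_le_sum[OF that _ D(2), of d] sum_nonneg[of D d] d_nonneg by (auto simp: c_def)
  have "c > 0"
    using sum_nonneg[of D d] d_nonneg by (auto simp: c_def)
  \<comment> \<open>One step: apply \<open>A\<close>, then return to \<open>B\<close> by one of the chosen operators.\<close>
  have "\<exists>y\<in>B. \<forall>k. norm ((A ^^ k) y) \<le> c * norm ((A ^^ Suc k) x)" if "x \<in> B" for x
  proof -
    have "A x \<in> closure (A ` B)"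
      using that closure_subset[of "A ` B"] by blast
    then obtain P where P: "P \<in> D" "P (A x) \<in> B"
      using D(3) by auto
    have "norm ((A ^^ k) (P (A x))) \<le> c * norm ((A ^^ Suc k) x)" for k
    proof -
      have "norm ((A ^^ k) (P (A x))) \<le> d P * norm ((A ^^ k) (A x))"
        using d[OF P(1)] by (simp add: controlled_def)
      also have "\<dots> \<le> c * norm ((A ^^ k) (A x))"
        using c[OF P(1)] by (intro mult_right_mono) auto
      finally show ?thesis
        by (simp add: funpow_swap1)
    qed
    with P show ?thesis
      by blast
  qed
  then obtain g where g: "\<And>x. x \<in> B \<Longrightarrow> g x \<in> B"
      "\<And>x k. x \<in> B \<Longrightarrow> norm ((A ^^ k) (g x)) \<le> c * norm ((A ^^ Suc k) x)"
    by metis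
  have x_B: "(g ^^ m) z \<in> B" for m
    by (induction m) (auto simp: g, simp add: B_def)
  have x_norm: "norm ((A ^^ k) ((g ^^ m) z)) \<le> c ^ m * norm ((A ^^ (k + m)) z)" for k m
  proof (induction m arbitrary: k)
    case (Suc m)
    have "norm ((A ^^ k) ((g ^^ Suc m) z)) \<le> c * norm ((A ^^ Suc k) ((g ^^ m) z))"
      using g(2)[OF x_B[of m], of k] by simp
    also have "\<dots> \<le> c * (c ^ m * norm ((A ^^ (Suc k + m)) z))"
      using Suc[of "Suc k"] \<open>c > 0\<close> by (intro mult_left_mono) auto
    finally show ?case
      by (simp add: mult.assoc)
  qed simp
  have AK: "(A ^^ (2 * m)) x = (K ^^ m) x" for m x
    by (induction m) (auto simp: K_def)
  \<comment> \<open>Two steps of the iteration cost \<open>c\<^sup>2\<close>; decay at rate \<open>1 / (2 c\<^sup>2)\<close> beats this by \<open>1 / 2\<close>.\<close>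
  have "2 * c\<^sup>2 > 0"
    using \<open>c > 0\<close> by simp
  then obtain C where C: "\<And>m. norm ((K ^^ m) z) \<le> C / (2 * c\<^sup>2) ^ m"
    using K_power_decay by blast
  have "1 \<le> C * (1 / 2) ^ m" for m
  proof -
    have "b \<le> norm (A ((g ^^ (2 * m)) z))"
      by (rule A_B[OF x_B])
    also have "\<dots> \<le> b * norm ((g ^^ (2 * m)) z)"
      by (rule b)
    finally have "1 \<le> norm ((g ^^ (2 * m)) z)"
      using b(1) by simp
    also have "\<dots> \<le> c ^ (2 * m) * norm ((K ^^ m) z)"
      using x_norm[of 0 "2 * m"] by (simp add: AK)
    also have "\<dots> \<le> c ^ (2 * m) * (C / (2 * c\<^sup>2) ^ m)"
      using C[of m] \<open>c > 0\<close> by (intro mult_left_mono) auto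
    also have "\<dots> = C * (1 / 2) ^ m"
      using \<open>c > 0\<close> by (simp add: power_mult power_mult_distrib power_divide)
    finally show ?thesis .
  qed
  moreover have "(\<lambda>m. C * (1 / 2) ^ m) \<longlonglongrightarrow> 0"
    by (intro tendsto_mult_right_zero LIMSEQ_power_zero) simp
  ultimately show False
    using LIMSEQ_le_const[of "\<lambda>m. C * (1 / 2) ^ m" 0 1] by auto
qed

end

section \<open>Norm limits of polynomials\<close>

lemma generated_invariant:
  fixes A :: "'a :: complex_hilbert \<Rightarrow> 'a"
  assumes M: "csubspace M" "closed M" "A ` M \<subseteq> M" and T: "T \<in> generated A"
  shows "blinfun_apply T ` M \<subseteq> M"
proof
  fix y assume "y \<in> blinfun_apply T ` M"
  then obtain x where x: "x \<in> M" "y = blinfun_apply T x"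
    by blast
  obtain P where P: "\<And>n. P n \<in> {P. \<exists>p. blinfun_apply P = poly_op p A}" and lim: "P \<longlonglongrightarrow> T"
    using T by (auto simp: generated_def closure_sequential)
  have "(A ^^ j) x \<in> M" for j
    by (induction j) (use M x in auto)
  then have "poly_op p A x \<in> M" for p
    unfolding poly_op_def
    by (intro complex_vector.subspace_sum[OF M(1)] complex_vector.subspace_scale[OF M(1)])
  then have "blinfun_apply (P n) x \<in> M" for n
    using P[of n] by auto
  moreover have "(\<lambda>n. blinfun_apply (P n) x) \<longlonglongrightarrow> blinfun_apply T x"
    by (intro tendsto_intros lim)
  ultimately show "y \<in> M"
    unfolding x(2) by (rule closed_sequentially[OF M(2)])
qed

theorem theorem3p3:
  fixes A :: "'a :: complex_hilbert \<Rightarrow> 'a"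
  assumes "separable TYPE('a)"
    and "\<exists>B :: 'a set. card B = 3 \<and> cindependent B"
    and "antilinear A"
    and "compact_operator A"
    and "A \<noteq> (\<lambda>x. 0)"
  shows "\<exists>M :: 'a set. csubspace M \<and> closed M \<and> M \<noteq> {0} \<and> M \<noteq> UNIV \<and>
           (\<forall>T \<in> generated A. blinfun_apply T ` M \<subseteq> M)"
proof (rule ccontr)
  assume "\<not> ?thesis"
  then have "transitive_compact_antilinear A"
    using assms generated_invariant[of _ A] by unfold_locales blast+
  then show False
    by (rule transitive_compact_antilinear.contradiction)
qed

end
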